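(* Let $X$ be a discrete space and $\omega:X^n\to X$ an $n$-ary operation on $X$ ($n\in\mathbb{N}$). Then $\omega$ has a continuous extension in the Stone-Čech compactification $(\iota_\beta,\beta X)$ if and only if for every $S\subseteq X$ the preimage $\omega^{-1}[S]$ is a finite union of rectangles, i.e. $$\omega^{-1}[S]=\bigcup_{i=1}^kR_i\quad\text{with}\quad R_i=A_{i,1}\times\dots\times A_{i,n},\qquad A_{i,j}\subseteq X.$$
   Context: $(\iota_\beta,\beta X)$ is the Stone-Čech compactification of the discrete space $X$ ($\beta X$ compact Hausdorff, $\iota_\beta:X\to\beta X$ with dense image, universal for maps of $X$ into compact spaces). A continuous extension of $\omega:X^n\to X$ in $(\iota_\beta,\beta X)$ is a (jointly) continuous map $\omega_\beta:(\beta X)^n\to\beta X$ such that $\iota_\beta(\omega(x_1,\dots,x_n))=\omega_\beta(\iota_\beta(x_1),\dots,\iota_\beta(x_n))$ for all $x_1,\dots,x_n\in X$. *)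

theory Defs
  imports "HOL-Analysis.Analysis"
begin

text \<open>
  Compact spaces are compact Hausdorff, as required of \<open>B\<close> itself.
  HOL cannot quantify over types inside a formula, so the test spaces of the universal property
  range over the topologies on subsets of the fixed type \<open>'a set set\<close>. This is no restriction:
  a point in the closure of the image of a map \<open>f\<close> on \<open>topspace T\<close> is determined by the family of
  those \<open>A\<close> for which it lies in the closure of \<open>f ` A\<close>. The universal property for test spaces
  over an arbitrary type is \<open>stone_cech_universal\<close> below. Only existence of the factorization is
  demanded; its uniqueness follows from density of the image (\<open>stone_cech_unique\<close>).
\<close>

definition stone_cech :: "'a topology \<Rightarrow> 'b topology \<Rightarrow> ('a \<Rightarrow> 'b) \<Rightarrow> bool" where
  "stone_cech T B \<iota> \<longleftrightarrow>
     compact_space B \<and> Hausdorff_space B \<and>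
     continuous_map T B \<iota> \<and>
     B closure_of (\<iota> ` topspace T) = topspace B \<and>
     (\<forall>(K :: 'a set set topology) f.
        compact_space K \<and> Hausdorff_space K \<and> continuous_map T K f \<longrightarrow>
        (\<exists>g. continuous_map B K g \<and> (\<forall>x\<in>topspace T. g (\<iota> x) = f x)))"

text \<open>
  The product \<open>Y\<^sup>n\<close> consists of the functions on \<open>{1..n}\<close> in \<open>PiE {1..n} (\<lambda>_. Y)\<close>, which take the
  value \<open>undefined\<close> outside \<open>{1..n}\<close>; hence the \<open>restrict\<close> in the image of a tuple under \<open>\<iota>\<close>.
\<close>

definition continuous_extension ::
    "nat \<Rightarrow> 'a set \<Rightarrow> 'b topology \<Rightarrow> ('a \<Rightarrow> 'b) \<Rightarrow> ((nat \<Rightarrow> 'a) \<Rightarrow> 'a) \<Rightarrow> ((nat \<Rightarrow> 'b) \<Rightarrow> 'b) \<Rightarrow> bool" where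
  "continuous_extension n X B \<iota> \<omega> \<omega>\<^sub>\<beta> \<longleftrightarrow>
     continuous_map (product_topology (\<lambda>_. B) {1..n}) B \<omega>\<^sub>\<beta> \<and>
     (\<forall>x \<in> (\<Pi>\<^sub>E j\<in>{1..n}. X). \<iota> (\<omega> x) = \<omega>\<^sub>\<beta> (\<lambda>j\<in>{1..n}. \<iota> (x j)))"

definition finite_union_of_rectangles :: "nat \<Rightarrow> 'a set \<Rightarrow> (nat \<Rightarrow> 'a) set \<Rightarrow> bool" where
  "finite_union_of_rectangles n X P \<longleftrightarrow>
     (\<exists>(k::nat) (A :: nat \<Rightarrow> nat \<Rightarrow> 'a set).
        (\<forall>i\<in>{1..k}. \<forall>j\<in>{1..n}. A i j \<subseteq> X) \<and>
        P = (\<Union>i\<in>{1..k}. \<Pi>\<^sub>E j\<in>{1..n}. A i j))"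


lemma stone_cech_unique:
  assumes "stone_cech T B \<iota>" "Hausdorff_space K"
    and "continuous_map B K g" "continuous_map B K h"
    and "\<And>x. x \<in> topspace T \<Longrightarrow> g (\<iota> x) = h (\<iota> x)"
    and "p \<in> topspace B"
  shows "g p = h p"
proof (rule forall_in_closure_of_eq[where X = B and Y = K and S = "\<iota> ` topspace T"])
  show "p \<in> B closure_of (\<iota> ` topspace T)"
    using assms(1,6) by (simp add: stone_cech_def)
qed (use assms in auto)

lemma stone_cech_universal:
  fixes T :: "'a topology" and K :: "'c topology"
  assumes sc: "stone_cech T B \<iota>"
    and K: "compact_space K" "Hausdorff_space K" and f: "continuous_map T K f"
  shows "\<exists>g. continuous_map B K g \<and> (\<forall>x\<in>topspace T. g (\<iota> x) = f x)"
proof -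
  define C where "C = K closure_of (f ` topspace T)"
  define K' where "K' = subtopology K C"
  define e where "e = (\<lambda>p. {A. A \<subseteq> topspace T \<and> p \<in> K closure_of (f ` A)})"
  define r where "r = inv_into C e"
  define L where "L = pullback_topology (e ` C) r K'"
  have fim: "f ` topspace T \<subseteq> topspace K"
    using f by (simp add: continuous_map_image_subset_topspace)
  have CK: "C \<subseteq> topspace K" by (simp add: C_def closure_of_subset_topspace)
  have topK': "topspace K' = C" using CK by (auto simp: K'_def)
  have fC: "f ` topspace T \<subseteq> C" using fim by (simp add: C_def closure_of_subset)
  have cK': "compact_space K'"
    unfolding K'_def by (rule compact_space_subtopology, rule closedin_compact_space[OF K(1)])
      (simp add: C_def)
  have hK': "Hausdorff_space K'"
    unfolding K'_def by (rule Hausdorff_space_subtopology[OF K(2)])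
  have inj: "inj_on e C"
  proof (rule inj_onI, rule ccontr)
    fix p q assume pq: "p \<in> C" "q \<in> C" "e p = e q" "p \<noteq> q"
    then obtain U V where UV: "openin K U" "openin K V" "p \<in> U" "q \<in> V" "disjnt U V"
      using K(2) CK unfolding Hausdorff_space_def by (metis subsetD)
    define A where "A = {x \<in> topspace T. f x \<in> U}"
    have "p \<in> K closure_of (f ` A)"
      unfolding in_closure_of
    proof (intro conjI allI impI)
      show "p \<in> topspace K" using pq CK by auto
      fix W assume W: "p \<in> W \<and> openin K W"
      then have "openin K (W \<inter> U)" "p \<in> W \<inter> U" using UV by auto
      then obtain y where "y \<in> f ` topspace T" "y \<in> W \<inter> U"
        using pq(1) unfolding C_def in_closure_of by blast
      then show "\<exists>y. y \<in> f ` A \<and> y \<in> W" by (auto simp: A_def)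
    qed
    then have "A \<in> e p" by (auto simp: e_def A_def)
    moreover have "q \<notin> K closure_of (f ` A)"
      using UV unfolding in_closure_of A_def disjnt_def by blast
    then have "A \<notin> e q" by (auto simp: e_def)
    ultimately show False using pq by simp
  qed
  have re: "r (e p) = p" if "p \<in> C" for p using inj that by (simp add: r_def)
  have rC: "r y \<in> C" if "y \<in> e ` C" for y using that re by auto
  have topL: "topspace L = e ` C"
    unfolding L_def topspace_pullback_topology topK' using rC by auto
  have cr: "continuous_map L K' r"
    using continuous_map_pullback[OF continuous_map_id, of "e ` C" r K'] by (simp add: L_def)
  have ce: "continuous_map K' L e"
    unfolding L_def
  proof (rule continuous_map_pullback')
    show "continuous_map K' K' (r \<circ> e)"
      by (rule continuous_map_eq[OF continuous_map_id]) (simp add: topK' re)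
    show "topspace K' \<subseteq> e -` e ` C" by (auto simp: topK')
  qed
  have "homeomorphic_maps K' L e r"
    unfolding homeomorphic_maps_def using ce cr re by (auto simp: topK' topL)
  then have hom: "K' homeomorphic_space L"
    by (auto simp: homeomorphic_space_def)
  have "compact_space L" "Hausdorff_space L"
    using homeomorphic_compact_space[OF hom] homeomorphic_Hausdorff_space[OF hom] cK' hK' by auto
  moreover have "continuous_map T K' f"
    unfolding K'_def using f fC by (auto simp: continuous_map_in_subtopology)
  then have "continuous_map T L (e \<circ> f)"
    using ce by (rule continuous_map_compose)
  ultimately obtain g where g: "continuous_map B L g" "\<forall>x\<in>topspace T. g (\<iota> x) = (e \<circ> f) x"
    using sc unfolding stone_cech_def by blast
  have "continuous_map B K' (r \<circ> g)" using g(1) cr by (rule continuous_map_compose)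
  then have "continuous_map B K (r \<circ> g)"
    unfolding K'_def by (simp add: continuous_map_in_subtopology)
  moreover have "\<forall>x\<in>topspace T. (r \<circ> g) (\<iota> x) = f x"
    using g(2) re fC by auto
  ultimately show ?thesis by blast
qed

text \<open>
  Every discrete space has a Stone--Cech compactification in the above sense: the closure of the
  set of principal ultrafilters (as indicator functions) in the Cantor cube over the power set.
\<close>

lemma stone_cech_discrete_exists:
  fixes X :: "'a set"
  shows "\<exists>(B :: ('a set \<Rightarrow> bool) topology) \<iota>. stone_cech (discrete_topology X) B \<iota>"
proof -
  define \<iota> where "\<iota> = (\<lambda>(x::'a) (A::'a set). x \<in> A)"
  define P where "P = product_topology (\<lambda>_::'a set. discrete_topology (UNIV::bool set)) UNIV"
  define Q where "Q = P closure_of (\<iota> ` X)"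
  define B where "B = subtopology P Q"
  have topP: "topspace P = UNIV" by (auto simp: P_def)
  have cP: "compact_space P"
    unfolding P_def by (auto simp: compact_space_product_topology compact_space_discrete_topology)
  have hP: "Hausdorff_space P"
    unfolding P_def by (auto simp: Hausdorff_space_product_topology)
  have topB: "topspace B = Q" by (simp add: B_def topP)
  have cB: "compact_space B"
    unfolding B_def by (rule compact_space_subtopology, rule closedin_compact_space[OF cP])
      (simp add: Q_def)
  have hB: "Hausdorff_space B" unfolding B_def by (rule Hausdorff_space_subtopology[OF hP])
  have iQ: "\<iota> ` X \<subseteq> Q" unfolding Q_def by (rule closure_of_subset) (simp add: topP)
  have dense: "B closure_of (\<iota> ` X) = Q"
  proof -
    have "Q \<inter> \<iota> ` X = \<iota> ` X" using iQ by auto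
    then show ?thesis unfolding B_def closure_of_subtopology by (simp add: Q_def)
  qed
  have coord: "openin P {p. p A = b}" for A :: "'a set" and b
  proof -
    have "continuous_map P (discrete_topology UNIV) (\<lambda>p. p A)"
      unfolding P_def by (rule continuous_map_product_projection) simp
    then have "openin P {p \<in> topspace P. p A \<in> {b}}"
      by (rule openin_continuous_map_preimage) simp
    then show ?thesis by (simp add: topP)
  qed
  have approx: "\<exists>x\<in>X. \<forall>A\<in>F. (x \<in> A) = p A" if p: "p \<in> Q" and F: "finite F" for p F
  proof -
    have "openin P (\<Inter>A\<in>F. {q. q A = p A})"
    proof (cases "F = {}")
      case True
      then show ?thesis using openin_topspace[of P] by (simp add: topP)
    next
      case False
      show ?thesis by (rule openin_INT2) (use F False coord in auto)
    qed
    moreover have "p \<in> (\<Inter>A\<in>F. {q. q A = p A})" by simp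
    moreover have "\<forall>N. p \<in> N \<and> openin P N \<longrightarrow> (\<exists>y. y \<in> \<iota> ` X \<and> y \<in> N)"
      using p unfolding Q_def in_closure_of by (rule conjunct2)
    ultimately obtain y where "y \<in> \<iota> ` X" "y \<in> (\<Inter>A\<in>F. {q. q A = p A})"
      by meson
    then show ?thesis by (auto simp: \<iota>_def)
  qed
  have univ: "\<exists>g. continuous_map B K g \<and> (\<forall>x\<in>X. g (\<iota> x) = f x)"
    if K: "compact_space K" "Hausdorff_space K" and f: "f \<in> X \<rightarrow> topspace K"
    for K :: "'a set set topology" and f
  proof -
    define lim where "lim = (\<lambda>p k. k \<in> topspace K \<and> (\<forall>U. openin K U \<and> k \<in> U \<longrightarrow> p {x \<in> X. f x \<in> U}))"
    have ex: "\<exists>k. lim p k" if p: "p \<in> Q" for p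
    proof (rule ccontr)
      assume "\<nexists>k. lim p k"
      then obtain u where u: "\<And>k. k \<in> topspace K \<Longrightarrow> openin K (u k) \<and> k \<in> u k \<and> \<not> p {x \<in> X. f x \<in> u k}"
        unfolding lim_def by metis
      have "\<exists>\<F>. finite \<F> \<and> \<F> \<subseteq> u ` topspace K \<and> topspace K \<subseteq> \<Union>\<F>"
      proof -
        have "(\<forall>U\<in>u ` topspace K. openin K U)" "topspace K \<subseteq> \<Union>(u ` topspace K)"
          using u by auto
        then show ?thesis using K(1) unfolding compact_space_alt by simp
      qed
      then obtain \<F> where F: "finite \<F>" "\<F> \<subseteq> u ` topspace K" "topspace K \<subseteq> \<Union>\<F>" by blast
      obtain x where x: "x \<in> X" "\<forall>A\<in>(\<lambda>U. {x \<in> X. f x \<in> U}) ` \<F>. (x \<in> A) = p A"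
        using approx[OF p, of "(\<lambda>U. {x \<in> X. f x \<in> U}) ` \<F>"] F(1) by auto
      have "f x \<in> topspace K" using f x by auto
      then obtain U where U: "U \<in> \<F>" "f x \<in> U" using F by blast
      then obtain k where "k \<in> topspace K" "U = u k" using F by blast
      then show False using u x U by auto
    qed
    have meet: "U \<inter> V \<noteq> {}" if "p \<in> Q" "p {x \<in> X. f x \<in> U}" "p {x \<in> X. f x \<in> V}" for p U V
    proof -
      have "\<exists>x\<in>X. \<forall>A\<in>{{x \<in> X. f x \<in> U}, {x \<in> X. f x \<in> V}}. (x \<in> A) = p A"
        by (rule approx) (use that in auto)
      then show ?thesis using that by auto
    qed
    define g where "g = (\<lambda>p. SOME k. lim p k)"
    have g: "lim p (g p)" if "p \<in> Q" for p
      unfolding g_def using ex[OF that] by (rule someI_ex)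
    have ext: "g (\<iota> x) = f x" if x: "x \<in> X" for x
    proof (rule ccontr)
      assume ne: "g (\<iota> x) \<noteq> f x"
      have l: "lim (\<iota> x) (g (\<iota> x))" using iQ x g by auto
      have "f x \<in> topspace K" using f x by auto
      moreover have "g (\<iota> x) \<in> topspace K" using l by (simp add: lim_def)
      ultimately obtain U V where UV: "openin K U" "openin K V" "g (\<iota> x) \<in> U" "f x \<in> V" "disjnt U V"
        using K(2) ne unfolding Hausdorff_space_def by metis
      then have "\<iota> x {x \<in> X. f x \<in> U}" using l by (simp add: lim_def)
      then show False using UV by (auto simp: \<iota>_def disjnt_def)
    qed
    have "continuous_map B K g"
      unfolding continuous_map_def
    proof (intro conjI allI impI)
      show "g \<in> topspace B \<rightarrow> topspace K" using g by (auto simp: topB lim_def)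
      fix U assume U: "openin K U"
      show "openin B {p \<in> topspace B. g p \<in> U}"
      proof (subst openin_subopen, intro ballI)
        fix p assume "p \<in> {p \<in> topspace B. g p \<in> U}"
        then have p: "p \<in> Q" "g p \<in> U" by (auto simp: topB)
        have "regular_space K" using K compact_Hausdorff_imp_regular_space by blast
        then have "neighbourhood_base_of (closedin K) K"
          by (simp add: neighbourhood_base_of_closedin)
        then have "\<exists>W V. openin K W \<and> closedin K V \<and> g p \<in> W \<and> W \<subseteq> V \<and> V \<subseteq> U"
          using U p(2) unfolding neighbourhood_base_of by blast
        then obtain W V where WV: "openin K W" "closedin K V" "g p \<in> W" "W \<subseteq> V" "V \<subseteq> U" by blast
        define N where "N = {q. q {x \<in> X. f x \<in> W} = True} \<inter> Q"
        have "openin B N" unfolding B_def N_def by (rule openin_subtopology_Int) (rule coord)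
        moreover have "p \<in> N" using g[OF p(1)] WV p by (auto simp: N_def lim_def)
        moreover have "g q \<in> U" if "q \<in> N" for q
        proof (rule ccontr)
          assume "g q \<notin> U"
          have q: "q \<in> Q" "q {x \<in> X. f x \<in> W}" using that by (auto simp: N_def)
          then have "g q \<in> topspace K - V" using g[OF q(1)] \<open>g q \<notin> U\<close> WV by (auto simp: lim_def)
          moreover have "openin K (topspace K - V)" using WV(2) by (simp add: closedin_def)
          ultimately have "q {x \<in> X. f x \<in> topspace K - V}"
            using g[OF q(1)] unfolding lim_def by blast
          then have "W \<inter> (topspace K - V) \<noteq> {}" using meet[OF q] by blast
          then show False using WV by auto
        qed
        ultimately show "\<exists>N. openin B N \<and> p \<in> N \<and> N \<subseteq> {p \<in> topspace B. g p \<in> U}"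
          by (intro exI[of _ N]) (auto simp: N_def topB)
      qed
    qed
    then show ?thesis using ext by blast
  qed
  have "stone_cech (discrete_topology X) B \<iota>"
    unfolding stone_cech_def using cB hB iQ dense univ
    by (auto simp: topB image_subset_iff)
  then show ?thesis by blast
qed

end

(* If \<omega>\<^sub>\<beta> exists and C is the clopen subset of \<beta>X that corresponds to S, then the preimage of C is
   open and compact in the power of \<beta>X, hence a finite union of open boxes; pulling the boxes back
   along \<iota> gives the rectangles.  Conversely, take the closure G of the graph of \<iota> \<circ> \<omega> in the
   product of the power of \<beta>X with \<beta>X.  It projects onto the power by compactness, and it is
   single-valued because clopen sets separate the points of \<beta>X and the preimage of each such clopen
   set is cut out by a clopen union of boxes.  A closed single-valued relation into a compact space
   is a continuous map. *)

theory Submission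
  imports Defs
begin

section \<open>Extending maps continuously from a dense image\<close>

text \<open>Taking closures of graphs yields a closed relation over all of \<open>P\<close>;
  \<open>sep\<close> is what makes this relation single-valued. It also forces
  \<open>g z = g z'\<close> whenever \<open>e z = e z'\<close>, so injectivity of \<open>e\<close>
  need not be assumed.\<close>

lemma continuous_map_extension_dense:
  fixes P :: "'p topology" and B :: "'b topology" and e :: "'z \<Rightarrow> 'p" and g :: "'z \<Rightarrow> 'b"
  assumes B: "compact_space B"
    and e: "e ` Z \<subseteq> topspace P" and dense: "P closure_of (e ` Z) = topspace P"
    and g: "g ` Z \<subseteq> topspace B"
    and sep: "\<And>q q'. \<lbrakk>q \<in> topspace B; q' \<in> topspace B; q \<noteq> q'\<rbrakk> \<Longrightarrow>
      \<exists>C D. closedin B C \<and> openin B C \<and> closedin P D \<and> openin P D \<and>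
            q \<in> C \<and> q' \<notin> C \<and> (\<forall>z\<in>Z. g z \<in> C \<longleftrightarrow> e z \<in> D)"
  shows "\<exists>h. continuous_map P B h \<and> (\<forall>z\<in>Z. h (e z) = g z)"
proof -
  define R where "R = prod_topology P B"
  define G where "G = R closure_of ((\<lambda>z. (e z, g z)) ` Z)"
  have topR: "topspace R = topspace P \<times> topspace B"
    by (simp add: R_def)
  have closedG: "closedin R G"
    by (simp add: G_def)
  have GR: "G \<subseteq> topspace P \<times> topspace B"
    using closedin_subset[OF closedG] by (simp add: topR)
  have graph: "(e z, g z) \<in> G" if "z \<in> Z" for z
    using closure_of_subset[of "(\<lambda>z. (e z, g z)) ` Z" R] e g that
    by (auto simp: G_def topR)
  have fst_closed: "closed_map R P fst"
    unfolding R_def by (rule closed_map_fst[OF B])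
  have "closedin P (fst ` G)"
    using fst_closed closedG by (simp add: closed_map_def)
  moreover have "e ` Z \<subseteq> fst ` G"
    using graph by force
  ultimately have "topspace P \<subseteq> fst ` G"
    using dense closure_of_minimal by metis
  then have total: "\<exists>q. (p, q) \<in> G" if "p \<in> topspace P" for p
    using that by force
  have single: "q = q'" if G: "(p, q) \<in> G" "(p, q') \<in> G" for p q q'
  proof (rule ccontr)
    assume ne: "q \<noteq> q'"
    have "q \<in> topspace B" "q' \<in> topspace B"
      using G GR by auto
    from sep[OF this ne] obtain C D
      where CD: "closedin B C" "openin B C" "closedin P D" "openin P D"
        and q: "q \<in> C" "q' \<notin> C" and iff: "\<forall>z\<in>Z. g z \<in> C \<longleftrightarrow> e z \<in> D"
      by blast
    \<comment> \<open>This closed set expresses "\<open>p\<close> lies in \<open>D\<close> iff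
      \<open>q\<close> lies in \<open>C\<close>". All graph points satisfy it, so all of
      \<open>G\<close> does; then \<open>q\<close> puts \<open>p\<close> into \<open>D\<close> while
      \<open>q'\<close> puts \<open>p\<close> outside \<open>D\<close>.\<close>
    have "closedin R (D \<times> C \<union> (topspace P - D) \<times> (topspace B - C))"
      unfolding R_def using CD by (intro closedin_Un) (auto simp: closedin_prod_Times_iff)
    moreover have "(\<lambda>z. (e z, g z)) ` Z \<subseteq> D \<times> C \<union> (topspace P - D) \<times> (topspace B - C)"
      using iff e g by auto
    ultimately have "G \<subseteq> D \<times> C \<union> (topspace P - D) \<times> (topspace B - C)"
      unfolding G_def by (simp add: closure_of_minimal)
    then show False
      using G q by blast
  qed
  define h where "h p = (SOME q. (p, q) \<in> G)" for p
  have h: "(p, h p) \<in> G" if "p \<in> topspace P" for p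
    unfolding h_def using total[OF that] by (rule someI_ex)
  have "continuous_map P B h"
    unfolding continuous_map_closedin
  proof (intro conjI allI impI)
    show "h \<in> topspace P \<rightarrow> topspace B"
      using h GR by blast
    fix K assume K: "closedin B K"
    \<comment> \<open>By single-valuedness, the preimage of \<open>K\<close> under \<open>h\<close>
      is the projection of the part of \<open>G\<close> lying over \<open>K\<close>.\<close>
    have "closedin R (G \<inter> (topspace P \<times> K))"
      using closedG K by (intro closedin_Int) (auto simp: R_def closedin_prod_Times_iff)
    then have "closedin P (fst ` (G \<inter> (topspace P \<times> K)))"
      using fst_closed unfolding closed_map_def by blast
    moreover have "fst ` (G \<inter> (topspace P \<times> K)) = {p \<in> topspace P. h p \<in> K}"
    proof (intro equalityI subsetI)
      fix p assume "p \<in> fst ` (G \<inter> (topspace P \<times> K))"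
      then obtain q where "(p, q) \<in> G" "p \<in> topspace P" "q \<in> K"
        by auto
      then show "p \<in> {p \<in> topspace P. h p \<in> K}"
        using single h by blast
    next
      fix p assume "p \<in> {p \<in> topspace P. h p \<in> K}"
      then show "p \<in> fst ` (G \<inter> (topspace P \<times> K))"
        using h by (force intro: image_eqI[of _ _ "(p, h p)"])
    qed
    ultimately show "closedin P {p \<in> topspace P. h p \<in> K}"
      by simp
  qed
  moreover have "h (e z) = g z" if "z \<in> Z" for z
    using single h graph that e by blast
  ultimately show ?thesis
    by blast
qed

section \<open>Clopen subsets of the compactification\<close>

text \<open>The indicator function of \<open>S\<close> is continuous on a discrete space, so it
  extends to the compactification; \<open>C\<close> is the set where the extension is
  \<open>True\<close>.\<close>

lemma stone_cech_discrete_clopen: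
  assumes "stone_cech (discrete_topology X) B \<iota>"
  obtains C where "closedin B C" "openin B C" "\<And>x. x \<in> X \<Longrightarrow> \<iota> x \<in> C \<longleftrightarrow> x \<in> S"
proof -
  let ?K = "discrete_topology (UNIV :: bool set)"
  \<comment> \<open>The test space has points of type \<open>bool\<close>, so the universal property
    is taken in its form for arbitrary types.\<close>
  have "\<exists>g. continuous_map B ?K g \<and> (\<forall>x\<in>topspace (discrete_topology X). g (\<iota> x) = (x \<in> S))"
    by (rule stone_cech_universal[OF assms])
       (auto simp: compact_space_discrete_topology)
  then obtain g where g: "continuous_map B ?K g" "\<forall>x\<in>X. g (\<iota> x) = (x \<in> S)"
    by auto
  have \<iota>: "\<iota> x \<in> topspace B" if "x \<in> X" for x
    using assms that by (auto simp: stone_cech_def)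
  show thesis
  proof (rule that[of "{p \<in> topspace B. g p \<in> {True}}"])
    show "closedin B {p \<in> topspace B. g p \<in> {True}}"
      by (rule closedin_continuous_map_preimage[OF g(1)]) simp
    show "openin B {p \<in> topspace B. g p \<in> {True}}"
      by (rule openin_continuous_map_preimage[OF g(1)]) simp
  qed (use g \<iota> in auto)
qed

text \<open>Take disjoint open neighbourhoods \<open>U\<close>, \<open>V\<close> and the clopen
  \<open>C\<close> having the same trace on \<iota>[X] as \<open>U\<close>. Then
  \<open>U - C\<close> and \<open>V \<inter> C\<close> are open and miss the dense image, hence are
  empty.\<close>

lemma stone_cech_discrete_separation:
  assumes sc: "stone_cech (discrete_topology X) B \<iota>"
    and q: "q \<in> topspace B" "q' \<in> topspace B" "q \<noteq> q'"
  obtains C where "closedin B C" "openin B C" "q \<in> C" "q' \<notin> C"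
proof -
  have "Hausdorff_space B" and dense: "B closure_of (\<iota> ` X) = topspace B"
    using sc by (auto simp: stone_cech_def)
  then obtain U V where UV: "openin B U" "openin B V" "q \<in> U" "q' \<in> V" "disjnt U V"
    using q unfolding Hausdorff_space_def by metis
  have meets: "\<exists>x\<in>X. \<iota> x \<in> W" if "openin B W" "r \<in> W" for W r
  proof -
    have "r \<in> B closure_of (\<iota> ` X)"
      using dense openin_subset[OF that(1)] that(2) by blast
    then show ?thesis
      using that unfolding in_closure_of by blast
  qed
  obtain C where C: "closedin B C" "openin B C"
    and C_iff: "\<And>x. x \<in> X \<Longrightarrow> \<iota> x \<in> C \<longleftrightarrow> x \<in> {x. \<iota> x \<in> U}"
    using stone_cech_discrete_clopen[OF sc, of "{x. \<iota> x \<in> U}"] by blast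
  show thesis
  proof (rule that[OF C])
    show "q \<in> C"
      using meets[of "U - C" q] UV C C_iff by (auto simp: openin_diff)
    show "q' \<notin> C"
      using meets[of "V \<inter> C" q'] UV C C_iff by (auto simp: disjnt_iff)
  qed
qed

section \<open>From an extension to rectangles\<close>

text \<open>Openness gives each point of \<open>Q\<close> a basic box inside \<open>Q\<close>;
  compactness leaves finitely many of them, and their union is exactly \<open>Q\<close>.\<close>

lemma compactin_product_finite_union_boxes:
  assumes "compactin (product_topology Y I) Q" "openin (product_topology Y I) Q"
  obtains k :: nat and U where "\<And>i j. j \<in> I \<Longrightarrow> i \<in> {1..k} \<Longrightarrow> openin (Y j) (U i j)"
    and "Q = (\<Union>i\<in>{1..k}. \<Pi>\<^sub>E j\<in>I. U i j)"
proof -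
  let ?box = "\<lambda>p u. finite {j \<in> I. u j \<noteq> topspace (Y j)} \<and> (\<forall>j\<in>I. openin (Y j) (u j)) \<and>
      p \<in> Pi\<^sub>E I u \<and> Pi\<^sub>E I u \<subseteq> Q"
  have "\<forall>p\<in>Q. \<exists>u. ?box p u"
    using assms(2) by (simp add: openin_product_topology_alt)
  then obtain u where "\<forall>p\<in>Q. ?box p (u p)"
    by (rule bchoice[THEN exE])
  then have u: "finite {j \<in> I. u p j \<noteq> topspace (Y j)}" "\<And>j. j \<in> I \<Longrightarrow> openin (Y j) (u p j)"
      "p \<in> Pi\<^sub>E I (u p)" "Pi\<^sub>E I (u p) \<subseteq> Q" if "p \<in> Q" for p
    using that by simp_all
  have "openin (product_topology Y I) (Pi\<^sub>E I (u p))" if "p \<in> Q" for p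
    using u(1,2)[OF that] by (subst openin_PiE_gen) blast
  moreover have "Q \<subseteq> \<Union>((\<lambda>p. Pi\<^sub>E I (u p)) ` Q)"
    using u(3) by blast
  ultimately have "\<exists>\<F>. finite \<F> \<and> \<F> \<subseteq> (\<lambda>p. Pi\<^sub>E I (u p)) ` Q \<and> Q \<subseteq> \<Union>\<F>"
    by (intro compactinD[OF assms(1)]) auto
  then obtain F where F: "finite F" "F \<subseteq> Q" "Q \<subseteq> (\<Union>p\<in>F. Pi\<^sub>E I (u p))"
    by (metis finite_subset_image)
  \<comment> \<open>Numbering the chosen points from 1 gives the index range used in
    \<open>finite_union_of_rectangles\<close>; an empty \<open>Q\<close> yields
    \<open>k = 0\<close>.\<close>
  obtain h where "bij_betw h {1..card F} F"
    using ex_bij_betw_nat_finite_1[OF F(1)] by blast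
  then have h: "h ` {1..card F} = F"
    by (rule bij_betw_imp_surj_on)
  show thesis
  proof (rule that[of "card F" "\<lambda>i. u (h i)"])
    have "Q = (\<Union>p\<in>h ` {1..card F}. Pi\<^sub>E I (u p))"
      unfolding h using F u(4) by blast
    then show "Q = (\<Union>i\<in>{1..card F}. \<Pi>\<^sub>E j\<in>I. u (h i) j)"
      by (simp only: image_image)
  qed (use h F u(2) in blast)
qed

lemma continuous_extension_imp_rectangles:
  assumes \<omega>: "\<omega> \<in> (\<Pi>\<^sub>E j\<in>{1..n}. X) \<rightarrow> X"
    and sc: "stone_cech (discrete_topology X) B \<iota>"
    and ext: "continuous_extension n X B \<iota> \<omega> \<omega>\<^sub>\<beta>"
  shows "finite_union_of_rectangles n X {x \<in> (\<Pi>\<^sub>E j\<in>{1..n}. X). \<omega> x \<in> S}"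
proof -
  define P where "P = product_topology (\<lambda>_. B) {1..n}"
  have cont: "continuous_map P B \<omega>\<^sub>\<beta>"
    and eq: "\<And>x. x \<in> (\<Pi>\<^sub>E j\<in>{1..n}. X) \<Longrightarrow> \<iota> (\<omega> x) = \<omega>\<^sub>\<beta> (\<lambda>j\<in>{1..n}. \<iota> (x j))"
    using ext by (auto simp: continuous_extension_def P_def)
  have \<iota>: "\<iota> x \<in> topspace B" if "x \<in> X" for x
    using sc that by (auto simp: stone_cech_def)
  have "compact_space P"
    using sc by (auto simp: P_def stone_cech_def compact_space_product_topology)
  obtain C where C: "closedin B C" "openin B C" "\<And>x. x \<in> X \<Longrightarrow> \<iota> x \<in> C \<longleftrightarrow> x \<in> S"
    using stone_cech_discrete_clopen[OF sc, of S] by blast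
  define Q where "Q = {p \<in> topspace P. \<omega>\<^sub>\<beta> p \<in> C}"
  have "openin P Q"
    unfolding Q_def by (rule openin_continuous_map_preimage[OF cont C(2)])
  moreover have "closedin P Q"
    unfolding Q_def by (rule closedin_continuous_map_preimage[OF cont C(1)])
  then have "compactin P Q"
    using \<open>compact_space P\<close> by (simp add: closedin_compact_space)
  ultimately obtain k :: nat and U where Q: "Q = (\<Union>i\<in>{1..k}. \<Pi>\<^sub>E j\<in>{1..n}. U i j)"
    unfolding P_def by (metis compactin_product_finite_union_boxes)
  have mem: "\<omega> x \<in> S \<longleftrightarrow> (\<exists>i\<in>{1..k}. \<forall>j\<in>{1..n}. \<iota> (x j) \<in> U i j)"
    if x: "x \<in> (\<Pi>\<^sub>E j\<in>{1..n}. X)" for x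
  proof -
    have "\<omega> x \<in> X"
      using \<omega> x by blast
    then have "\<omega> x \<in> S \<longleftrightarrow> \<omega>\<^sub>\<beta> (\<lambda>j\<in>{1..n}. \<iota> (x j)) \<in> C"
      using C(3) eq[OF x] by metis
    also have "\<dots> \<longleftrightarrow> (\<lambda>j\<in>{1..n}. \<iota> (x j)) \<in> Q"
      using x \<iota> by (auto simp: Q_def P_def PiE_iff)
    also have "\<dots> \<longleftrightarrow> (\<exists>i\<in>{1..k}. \<forall>j\<in>{1..n}. \<iota> (x j) \<in> U i j)"
      by (simp add: Q PiE_iff)
    finally show ?thesis .
  qed
  \<comment> \<open>The sides of the rectangles are the traces on \<open>X\<close> of the sides of
    the boxes.\<close>
  define A where "A i j = {x \<in> X. \<iota> x \<in> U i j}" for i j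
  have "{x \<in> (\<Pi>\<^sub>E j\<in>{1..n}. X). \<omega> x \<in> S} = (\<Union>i\<in>{1..k}. \<Pi>\<^sub>E j\<in>{1..n}. A i j)"
  proof (intro equalityI subsetI)
    fix x assume "x \<in> {x \<in> (\<Pi>\<^sub>E j\<in>{1..n}. X). \<omega> x \<in> S}"
    then show "x \<in> (\<Union>i\<in>{1..k}. \<Pi>\<^sub>E j\<in>{1..n}. A i j)"
      using mem[of x] by (auto simp: A_def PiE_iff)
  next
    fix x assume x: "x \<in> (\<Union>i\<in>{1..k}. \<Pi>\<^sub>E j\<in>{1..n}. A i j)"
    then have "x \<in> (\<Pi>\<^sub>E j\<in>{1..n}. X)"
      by (auto simp: A_def PiE_iff)
    then show "x \<in> {x \<in> (\<Pi>\<^sub>E j\<in>{1..n}. X). \<omega> x \<in> S}"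
      using mem[of x] x by (auto simp: A_def PiE_iff)
  qed
  moreover have "\<forall>i\<in>{1..k}. \<forall>j\<in>{1..n}. A i j \<subseteq> X"
    by (auto simp: A_def)
  ultimately show ?thesis
    unfolding finite_union_of_rectangles_def by blast
qed

section \<open>From rectangles to an extension\<close>

text \<open>Replace every side by a clopen set of \<open>B\<close> with that trace on
  \<open>X\<close>. The union is closed because there are finitely many boxes, and open because each
  box has finitely many factors.\<close>

lemma rectangles_clopen:
  assumes sc: "stone_cech (discrete_topology X) B \<iota>"
    and rect: "finite_union_of_rectangles n X T"
  obtains D where "closedin (product_topology (\<lambda>_. B) {1..n}) D"
    and "openin (product_topology (\<lambda>_. B) {1..n}) D"
    and "\<And>x. x \<in> (\<Pi>\<^sub>E j\<in>{1..n}. X) \<Longrightarrow> (\<lambda>j\<in>{1..n}. \<iota> (x j)) \<in> D \<longleftrightarrow> x \<in> T"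
proof -
  obtain k :: nat and A where A: "T = (\<Union>i\<in>{1..k}. \<Pi>\<^sub>E j\<in>{1..n}. A i j)"
    using rect unfolding finite_union_of_rectangles_def by blast
  have "\<exists>C. closedin B C \<and> openin B C \<and> (\<forall>x\<in>X. \<iota> x \<in> C \<longleftrightarrow> x \<in> S)" for S
    by (metis stone_cech_discrete_clopen[OF sc])
  then obtain c where c: "\<And>S. closedin B (c S)" "\<And>S. openin B (c S)"
      "\<And>S x. x \<in> X \<Longrightarrow> \<iota> x \<in> c S \<longleftrightarrow> x \<in> S"
    by metis
  let ?D = "\<Union>i\<in>{1..k}. \<Pi>\<^sub>E j\<in>{1..n}. c (A i j)"
  show thesis
  proof (rule that[of ?D])
    show "closedin (product_topology (\<lambda>_. B) {1..n}) ?D"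
      using c by (intro closedin_Union) (auto simp: closedin_product_topology)
    show "openin (product_topology (\<lambda>_. B) {1..n}) ?D"
      using c by (intro openin_Union) (auto simp: openin_PiE)
    show "(\<lambda>j\<in>{1..n}. \<iota> (x j)) \<in> ?D \<longleftrightarrow> x \<in> T" if x: "x \<in> (\<Pi>\<^sub>E j\<in>{1..n}. X)" for x
    proof -
      have "x \<in> extensional {1..n}" "\<And>j. j \<in> {1..n} \<Longrightarrow> x j \<in> X"
        using x by (auto simp: PiE_iff)
      then show ?thesis
        by (simp add: A PiE_iff c(3))
    qed
  qed
qed

lemma rectangles_imp_continuous_extension:
  assumes \<omega>: "\<omega> \<in> (\<Pi>\<^sub>E j\<in>{1..n}. X) \<rightarrow> X"
    and sc: "stone_cech (discrete_topology X) B \<iota>"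
    and rect: "\<And>S. S \<subseteq> X \<Longrightarrow>
      finite_union_of_rectangles n X {x \<in> (\<Pi>\<^sub>E j\<in>{1..n}. X). \<omega> x \<in> S}"
  shows "\<exists>\<omega>\<^sub>\<beta>. continuous_extension n X B \<iota> \<omega> \<omega>\<^sub>\<beta>"
proof -
  define P where "P = product_topology (\<lambda>_. B) {1..n}"
  define Z where "Z = (\<Pi>\<^sub>E j\<in>{1..n}. X)"
  define e where "e x = (\<lambda>j\<in>{1..n}. \<iota> (x j))" for x :: "nat \<Rightarrow> 'a"
  have \<iota>: "\<iota> x \<in> topspace B" if "x \<in> X" for x
    using sc that by (auto simp: stone_cech_def)
  have \<omega>Z: "\<omega> z \<in> X" if "z \<in> Z" for z
    using \<omega> that by (auto simp: Z_def)
  \<comment> \<open>Written as a product, the image is dense because the closure of a product is the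
    product of the closures.\<close>
  have eZ: "e ` Z = (\<Pi>\<^sub>E j\<in>{1..n}. \<iota> ` X)"
  proof (intro equalityI subsetI)
    fix y assume y: "y \<in> (\<Pi>\<^sub>E j\<in>{1..n}. \<iota> ` X)"
    define x where "x = (\<lambda>j\<in>{1..n}. inv_into X \<iota> (y j))"
    have "x \<in> Z"
      using y by (auto simp: x_def Z_def PiE_iff inv_into_into)
    moreover have "y = e x"
    proof (rule extensionalityI[of _ "{1..n}"])
      show "y j = e x j" if "j \<in> {1..n}" for j
        using f_inv_into_f[OF PiE_mem[OF y that]] that by (simp add: e_def x_def)
    qed (use y in \<open>auto simp: e_def PiE_iff\<close>)
    ultimately show "y \<in> e ` Z"
      by blast
  qed (auto simp: e_def Z_def PiE_iff)
  have "\<exists>h. continuous_map P B h \<and> (\<forall>z\<in>Z. h (e z) = (\<iota> \<circ> \<omega>) z)"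
  proof (rule continuous_map_extension_dense)
    show "compact_space B"
      using sc by (simp add: stone_cech_def)
    show "e ` Z \<subseteq> topspace P"
      unfolding eZ P_def topspace_product_topology by (rule PiE_mono) (use \<iota> in auto)
    show "P closure_of (e ` Z) = topspace P"
      using sc by (simp add: eZ P_def closure_of_product_topology stone_cech_def)
    show "(\<iota> \<circ> \<omega>) ` Z \<subseteq> topspace B"
      using \<iota> \<omega>Z by auto
  next
    fix q q' assume "q \<in> topspace B" "q' \<in> topspace B" "q \<noteq> q'"
    then obtain C where C: "closedin B C" "openin B C" "q \<in> C" "q' \<notin> C"
      by (rule stone_cech_discrete_separation[OF sc])
    \<comment> \<open>With \<open>S\<close> the trace of \<open>C\<close>,
      \<open>(\<iota> \<circ> \<omega>) z \<in> C\<close> means \<open>\<omega> z \<in> S\<close>.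
      The rectangles for this \<open>S\<close> supply the clopen \<open>D\<close> that transfers the
      separation to \<open>P\<close>.\<close>
    define S where "S = {x \<in> X. \<iota> x \<in> C}"
    have "finite_union_of_rectangles n X {x \<in> Z. \<omega> x \<in> S}"
      unfolding Z_def by (rule rect) (auto simp: S_def)
    then obtain D where D: "closedin P D" "openin P D"
      "\<And>z. z \<in> Z \<Longrightarrow> e z \<in> D \<longleftrightarrow> z \<in> {x \<in> Z. \<omega> x \<in> S}"
      using rectangles_clopen[OF sc] unfolding P_def Z_def e_def by blast
    have "\<forall>z\<in>Z. (\<iota> \<circ> \<omega>) z \<in> C \<longleftrightarrow> e z \<in> D"
      using D(3) \<omega>Z by (auto simp: S_def)
    then show "\<exists>C D. closedin B C \<and> openin B C \<and> closedin P D \<and> openin P D \<and>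
        q \<in> C \<and> q' \<notin> C \<and> (\<forall>z\<in>Z. (\<iota> \<circ> \<omega>) z \<in> C \<longleftrightarrow> e z \<in> D)"
      using C D by blast
  qed
  then obtain h where "continuous_map P B h" "\<forall>z\<in>Z. h (e z) = \<iota> (\<omega> z)"
    by auto
  then have "continuous_extension n X B \<iota> \<omega> h"
    by (simp add: continuous_extension_def P_def Z_def e_def)
  then show ?thesis
    by blast
qed

theorem theorem1:
  fixes X :: "'a set" and n :: nat and \<omega> :: "(nat \<Rightarrow> 'a) \<Rightarrow> 'a"
    and B :: "'b topology" and \<iota> :: "'a \<Rightarrow> 'b"
  assumes "\<omega> \<in> (\<Pi>\<^sub>E j\<in>{1..n}. X) \<rightarrow> X"
    and "stone_cech (discrete_topology X) B \<iota>"
  shows "(\<exists>\<omega>\<^sub>\<beta>. continuous_extension n X B \<iota> \<omega> \<omega>\<^sub>\<beta>) \<longleftrightarrow>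
         (\<forall>S\<subseteq>X. finite_union_of_rectangles n X {x \<in> (\<Pi>\<^sub>E j\<in>{1..n}. X). \<omega> x \<in> S})"
  using continuous_extension_imp_rectangles[OF assms] rectangles_imp_continuous_extension[OF assms]
  by blast

end
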